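(* Let $\textbf{G}$ be a state tree structure with plant agents $\textbf{P}_1,\ldots,\textbf{P}_n$ having pairwise disjoint alphabets $\Sigma_k=\Sigma_{c,k}\,\dot\cup\,\Sigma_{u,k}$, and let $P$ be a predicate of illegal basic trees with $\sup\mathcal{NC}(\neg P)\wedge P_0\neq false$. Let $\textbf{SUP}=(\textbf{G}^f,\{f_\sigma \mid \sigma\in\Sigma_c\})$ be the monolithic optimal nonblocking supervisor, with state set $B_S$. For each $k\in[1,n]$ let $\mathcal{C}_k=\{B_{k,i}\subseteq B_S\mid i\in I_k\}$ be a control cover on $B_S$ with respect to $\Sigma_{c,k}$, let $\textbf{G}^f_k=(I_k,\Sigma_{l,k},\delta_k,i_{0,k},I_{m,k})$ be a local state tracker constructed from $\mathcal{C}_k$, and for $\sigma\in\Sigma_{c,k}$ let $g_\sigma:I_k\to\{0,1\}$ be the corresponding local control function. Then the pair $\textbf{LOC}=(\{\textbf{G}^f_k\mid k\in[1,n]\},\{g_\sigma,\ \sigma\in\Sigma_{c,k}\mid k\in[1,n]\})$ is control equivalent to $\textbf{SUP}$; namely, for every $k\in[1,n]$, every $\sigma\in\Sigma_{c,k}$ and every $b\in B_S$ there exists $i\in I_k$ such that $b\in B_{k,i}$ and (i) if $\Delta(b,\sigma)\neq\emptyset$, then $f_\sigma(b)=1$ if and only if $g_\sigma(i)=1$; (ii) $b\models P_m^f$ if and only if $b\models P_m$ and $i\in I_{m,k}$.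
   Context: **State tree structures.** A state tree structure $\textbf{G}=(\textbf{S}T,\mathcal{H},\Sigma,\Delta,P_0,P_m)$ enters the claim only through the following data: the finite set $\mathcal{B}(\textbf{S}T)$ of basic trees (the "flat" system states); the finite event set $\Sigma=\Sigma_c\,\dot\cup\,\Sigma_u$ (controllable / uncontrollable events); the transition function $\Delta$, where for a basic tree $b$ and event $\sigma$, $\Delta(b,\sigma)$ is either $\emptyset$ ($\sigma$ not defined at $b$) or a single basic tree (identified with the corresponding one-element set when used as a set); and the initial and marker predicates $P_0,P_m$. A predicate is a function $Q:\mathcal{B}(\textbf{S}T)\to\{0,1\}$; $b\models Q$ means $Q(b)=1$; $Q\preceq Q'$ means $b\models Q\Rightarrow b\models Q'$ for all $b$; $\neg,\wedge,\vee$ are pointwise; $true$, $false$ are the constant predicates. $\textbf{G}$ models a plant composed of $n$ agents with pairwise disjoint alphabets $\Sigma_k=\Sigma_{c,k}\,\dot\cup\,\Sigma_{u,k}$, together with a specification over $\Sigma$; $\Sigma_c=\bigcup_k\Sigma_{c,k}$, $\Sigma_u=\bigcup_k\Sigma_{u,k}$. The predicate $P$ describes the illegal basic trees. **Monolithic supervisor.** $R(\textbf{G},Q)$ holds exactly on basic trees reachable in $\textbf{G}$ from some $b_0\models Q\wedge P_0$ by a path of basic trees all satisfying $Q$; $CR(\textbf{G},Q)$ holds exactly on basic trees from which some $b_m\models Q\wedge P_m$ can be reached by a path of basic trees all satisfying $Q$. $Q$ is nonblocking if $R(\textbf{G},Q)\preceq CR(\textbf{G},Q)$. $Q$ is weakly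 controllable if for all $\sigma\in\Sigma_u$ and $b\models Q$, either $\Delta(b,\sigma)=\emptyset$ or $\Delta(b,\sigma)\models Q$. $\sup\mathcal{NC}(\neg P)$ is the largest nonblocking and weakly controllable predicate $K\preceq\neg P$ (it exists). Put $S:=R(\textbf{G},\sup\mathcal{NC}(\neg P))$ and $B_S:=\{b\mid b\models S\}$. For $\sigma\in\Sigma$: $f_\sigma(b)=1$ if $\Delta(b,\sigma)=\emptyset$ or ($\Delta(b,\sigma)\neq\emptyset$ and $\Delta(b,\sigma)\models S$); $f_\sigma(b)=0$ if $\Delta(b,\sigma)\neq\emptyset$ and $\Delta(b,\sigma)\models\neg S$. The closed-loop transition function is $\Delta^f(b,\sigma)=\Delta(b,\sigma)$ if $f_\sigma(b)=1$ and $\emptyset$ otherwise. The set of basic trees reachable in the closed-loop system $\textbf{G}^f$ is $B_S$, i.e. $R(\textbf{G}^f,true)=S$, and $P_m^f:=S\wedge P_m$, $P_0^f:=S\wedge P_0$. **Control consistency and control covers.** $\Gamma(Q,\sigma)$ holds on $b$ iff $\Delta(b,\sigma)\neq\emptyset$ and $\Delta(b,\sigma)\models Q$. $Next_{\textbf{G}}(\sigma)$ holds on the basic trees that are reached by a one-step transition $\sigma$ from some basic tree. $N_{good}(\sigma):=Next_{\textbf{G}}(\sigma)\wedge S$, $N_{bad}(\sigma):=Next_{\textbf{G}}(\sigma)\wedge\neg S$. On $B_S$ define $E_\sigma:=\Gamma(N_{good}(\sigma),\sigma)\wedge S$, $D_\sigma:=\Gamma(N_{bad}(\sigma),\sigma)\wedge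 S$, $M(b)=1$ iff $b\models P_m^f$, $T(b)=1$ iff $b\models P_m$. The control consistency relation $\mathcal{R}_k\subseteq B_S\times B_S$ (with respect to $\Sigma_{c,k}$): $(b,b')\in\mathcal{R}_k$ iff (1) for all $\sigma\in\Sigma_{c,k}$, $E_\sigma(b)\wedge D_\sigma(b')=false=E_\sigma(b')\wedge D_\sigma(b)$; and (2) $T(b)=T(b')\Rightarrow M(b)=M(b')$. A cover $\mathcal{C}_k=\{B_{k,i}\subseteq B_S\mid i\in I_k\}$ of $B_S$ (nonempty cells with union $B_S$, possibly overlapping) is a control cover with respect to $\Sigma_{c,k}$ if (1) for all $i\in I_k$ and $b,b'\in B_{k,i}$, $(b,b')\in\mathcal{R}_k$; and (2) for all $i\in I_k$, $\sigma\in\Sigma$: if some $b\in B_{k,i}$ has $\Delta^f(b,\sigma)\neq\emptyset$, then there is $j\in I_k$ such that $\Delta^f(b',\sigma)\subseteq B_{k,j}$ for all $b'\in B_{k,i}$. **Local state tracker and local control functions.** Given $\mathcal{C}_k$: the state set is $I_k$; the initial state $i_{0,k}$ is the index of a cell containing the initial basic tree $b_0$; $I_{m,k}:=\{i\in I_k\mid B_{k,i}\cap\{b\in B_S\mid b\models P_m^f\}\neq\emptyset\}$. Define $\delta'_k:I_k\times\Sigma\to I_k$ (partial) by $\delta'_k(i,\sigma)=j$ if some $b\in B_{k,i}$ has $\Delta^f(b,\sigma)\neq\emptyset$ and $\Delta^f(b',\sigma)\subseteq B_{k,j}$ for all $b'\in B_{k,i}$ (if several $j$ qualify, one is chosen arbitrarily).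 $\Sigma_{l,k}:=\Sigma_k\,\dot\cup\,\{\sigma\in\Sigma\setminus\Sigma_k\mid(\exists i\neq j\in I_k)\ \delta'_k(i,\sigma)=j\}$, and $\delta_k$ is the restriction of $\delta'_k$ to $I_k\times\Sigma_{l,k}$. For $\sigma\in\Sigma_{c,k}$, $g_\sigma(i)=1$ iff there exists $b\in B_{k,i}$ with $b\models\Gamma(N_{good}(\sigma),\sigma)$. *)

theory Defs
  imports Main
begin

(* Basic trees are the elements of a type 'b, required to be finite where the
   structure is used.  The transition map is only meaningful on events of the
   alphabet.  None stands for the empty set, Some b' for the basic tree b';
   set_option turns such a value into the corresponding set. *)
record ('b, 'e) sts =
  ctrl_events :: "'e set"
  unctrl_events :: "'e set"
  transition :: "'b \<Rightarrow> 'e \<Rightarrow> 'b option"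
  init :: "'b \<Rightarrow> bool"
  marker :: "'b \<Rightarrow> bool"

definition events :: "('b, 'e) sts \<Rightarrow> 'e set" where
  "events G = ctrl_events G \<union> unctrl_events G"

definition state_tree_structure :: "('b::finite, 'e) sts \<Rightarrow> bool" where
  "state_tree_structure G \<longleftrightarrow>
     finite (events G) \<and> ctrl_events G \<inter> unctrl_events G = {}"

definition plant_agents ::
  "('b, 'e) sts \<Rightarrow> nat \<Rightarrow> (nat \<Rightarrow> 'e set) \<Rightarrow> (nat \<Rightarrow> 'e set) \<Rightarrow> bool" where
  "plant_agents G n Sc Su \<longleftrightarrow>
     (\<forall>k\<in>{1..n}. Sc k \<inter> Su k = {}) \<and>
     (\<forall>k\<in>{1..n}. \<forall>l\<in>{1..n}. k \<noteq> l \<longrightarrow> (Sc k \<union> Su k) \<inter> (Sc l \<union> Su l) = {}) \<and>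
     ctrl_events G = (\<Union>k\<in>{1..n}. Sc k) \<and>
     unctrl_events G = (\<Union>k\<in>{1..n}. Su k)"


section \<open>Monolithic supervisor\<close>

definition step_in :: "('b, 'e) sts \<Rightarrow> ('b \<Rightarrow> bool) \<Rightarrow> 'b \<Rightarrow> 'b \<Rightarrow> bool" where
  "step_in G Q b b' \<longleftrightarrow> Q b \<and> Q b' \<and> (\<exists>\<sigma>\<in>events G. transition G b \<sigma> = Some b')"

definition reachable :: "('b, 'e) sts \<Rightarrow> ('b \<Rightarrow> bool) \<Rightarrow> 'b \<Rightarrow> bool" where
  "reachable G Q b \<longleftrightarrow> (\<exists>b0. Q b0 \<and> init G b0 \<and> (step_in G Q)\<^sup>*\<^sup>* b0 b)"

definition coreachable :: "('b, 'e) sts \<Rightarrow> ('b \<Rightarrow> bool) \<Rightarrow> 'b \<Rightarrow> bool" where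
  "coreachable G Q b \<longleftrightarrow> (\<exists>bm. Q bm \<and> marker G bm \<and> (step_in G Q)\<^sup>*\<^sup>* b bm)"

definition nonblocking :: "('b, 'e) sts \<Rightarrow> ('b \<Rightarrow> bool) \<Rightarrow> bool" where
  "nonblocking G Q \<longleftrightarrow> reachable G Q \<le> coreachable G Q"

definition weakly_controllable :: "('b, 'e) sts \<Rightarrow> ('b \<Rightarrow> bool) \<Rightarrow> bool" where
  "weakly_controllable G Q \<longleftrightarrow>
     (\<forall>\<sigma>\<in>unctrl_events G. \<forall>b. Q b \<longrightarrow>
        transition G b \<sigma> = None \<or> (\<exists>b'. transition G b \<sigma> = Some b' \<and> Q b'))"

(* The largest element, not merely the pointwise join: nonblocking predicates
   need not be closed under joins, so the description is only informative for
   structures in which a largest element exists. *)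
definition supNC :: "('b, 'e) sts \<Rightarrow> ('b \<Rightarrow> bool) \<Rightarrow> 'b \<Rightarrow> bool" where
  "supNC G P = (GREATEST K. nonblocking G K \<and> weakly_controllable G K \<and> K \<le> - P)"

definition sup_pred :: "('b, 'e) sts \<Rightarrow> ('b \<Rightarrow> bool) \<Rightarrow> 'b \<Rightarrow> bool" where
  "sup_pred G P = reachable G (supNC G P)"

definition sup_states :: "('b, 'e) sts \<Rightarrow> ('b \<Rightarrow> bool) \<Rightarrow> 'b set" where
  "sup_states G P = {b. sup_pred G P b}"

definition control :: "('b, 'e) sts \<Rightarrow> ('b \<Rightarrow> bool) \<Rightarrow> 'e \<Rightarrow> 'b \<Rightarrow> bool" where
  "control G P \<sigma> b \<longleftrightarrow>
     (case transition G b \<sigma> of None \<Rightarrow> True | Some b' \<Rightarrow> sup_pred G P b')"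

definition closed_loop :: "('b, 'e) sts \<Rightarrow> ('b \<Rightarrow> bool) \<Rightarrow> ('b, 'e) sts" where
  "closed_loop G P = G\<lparr>
     transition := (\<lambda>b \<sigma>. if control G P \<sigma> b then transition G b \<sigma> else None),
     init := inf (sup_pred G P) (init G),
     marker := inf (sup_pred G P) (marker G)\<rparr>"

lemma reachable_closed_loop: "reachable (closed_loop G P) top = sup_pred G P"
proof (intro ext iffI)
  fix b assume "reachable (closed_loop G P) top b"
  then obtain b0 where b0: "sup_pred G P b0"
    and path: "(step_in (closed_loop G P) top)\<^sup>*\<^sup>* b0 b"
    by (auto simp: reachable_def closed_loop_def)
  from path b0 show "sup_pred G P b"
    by induction
      (auto simp: step_in_def closed_loop_def control_def split: if_splits)
next
  fix b assume "sup_pred G P b"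
  then obtain b0 where b0: "supNC G P b0" "init G b0"
    and path: "(step_in G (supNC G P))\<^sup>*\<^sup>* b0 b"
    by (auto simp: sup_pred_def reachable_def)
  have init: "init (closed_loop G P) b0"
    using b0 by (auto simp: closed_loop_def sup_pred_def reachable_def)
  from path have "(step_in (closed_loop G P) top)\<^sup>*\<^sup>* b0 b"
  proof induction
    case (step y z)
    have "sup_pred G P z"
      unfolding sup_pred_def reachable_def
      using b0 step(1,2) by (meson rtranclp.rtrancl_into_rtrancl)
    then have "step_in (closed_loop G P) top y z"
      using step(2) by (auto simp: step_in_def closed_loop_def control_def events_def)
    with step.IH show ?case by (rule rtranclp.rtrancl_into_rtrancl)
  qed simp
  with init show "reachable (closed_loop G P) top b"
    by (auto simp: reachable_def)
qed


section \<open>Control consistency and control covers\<close>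

definition Gam :: "('b, 'e) sts \<Rightarrow> ('b \<Rightarrow> bool) \<Rightarrow> 'e \<Rightarrow> 'b \<Rightarrow> bool" where
  "Gam G Q \<sigma> b \<longleftrightarrow> (\<exists>b'. transition G b \<sigma> = Some b' \<and> Q b')"

definition Next :: "('b, 'e) sts \<Rightarrow> 'e \<Rightarrow> 'b \<Rightarrow> bool" where
  "Next G \<sigma> b' \<longleftrightarrow> (\<exists>b. transition G b \<sigma> = Some b')"

definition N_good :: "('b, 'e) sts \<Rightarrow> ('b \<Rightarrow> bool) \<Rightarrow> 'e \<Rightarrow> 'b \<Rightarrow> bool" where
  "N_good G P \<sigma> = inf (Next G \<sigma>) (sup_pred G P)"

definition N_bad :: "('b, 'e) sts \<Rightarrow> ('b \<Rightarrow> bool) \<Rightarrow> 'e \<Rightarrow> 'b \<Rightarrow> bool" where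
  "N_bad G P \<sigma> = inf (Next G \<sigma>) (- sup_pred G P)"

definition En :: "('b, 'e) sts \<Rightarrow> ('b \<Rightarrow> bool) \<Rightarrow> 'e \<Rightarrow> 'b \<Rightarrow> bool" where
  "En G P \<sigma> = inf (Gam G (N_good G P \<sigma>) \<sigma>) (sup_pred G P)"

definition Dis :: "('b, 'e) sts \<Rightarrow> ('b \<Rightarrow> bool) \<Rightarrow> 'e \<Rightarrow> 'b \<Rightarrow> bool" where
  "Dis G P \<sigma> = inf (Gam G (N_bad G P \<sigma>) \<sigma>) (sup_pred G P)"

(* Third argument: the controllable alphabet of the agent. *)
definition control_consistent ::
  "('b, 'e) sts \<Rightarrow> ('b \<Rightarrow> bool) \<Rightarrow> 'e set \<Rightarrow> ('b \<times> 'b) set" where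
  "control_consistent G P Sck =
     {(b, b'). b \<in> sup_states G P \<and> b' \<in> sup_states G P \<and>
        (\<forall>\<sigma>\<in>Sck. \<not> (En G P \<sigma> b \<and> Dis G P \<sigma> b') \<and> \<not> (En G P \<sigma> b' \<and> Dis G P \<sigma> b)) \<and>
        (marker G b = marker G b' \<longrightarrow>
           marker (closed_loop G P) b = marker (closed_loop G P) b')}"

definition cover :: "'b set \<Rightarrow> 'i set \<Rightarrow> ('i \<Rightarrow> 'b set) \<Rightarrow> bool" where
  "cover X I B \<longleftrightarrow> (\<forall>i\<in>I. B i \<noteq> {} \<and> B i \<subseteq> X) \<and> (\<Union>i\<in>I. B i) = X"

definition control_cover ::
  "('b, 'e) sts \<Rightarrow> ('b \<Rightarrow> bool) \<Rightarrow> 'e set \<Rightarrow> 'i set \<Rightarrow> ('i \<Rightarrow> 'b set) \<Rightarrow> bool" where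
  "control_cover G P Sck I B \<longleftrightarrow>
     cover (sup_states G P) I B \<and>
     (\<forall>i\<in>I. \<forall>b\<in>B i. \<forall>b'\<in>B i. (b, b') \<in> control_consistent G P Sck) \<and>
     (\<forall>i\<in>I. \<forall>\<sigma>\<in>events G.
        (\<exists>b\<in>B i. transition (closed_loop G P) b \<sigma> \<noteq> None) \<longrightarrow>
        (\<exists>j\<in>I. \<forall>b'\<in>B i. set_option (transition (closed_loop G P) b' \<sigma>) \<subseteq> B j))"


section \<open>Local state trackers and local control functions\<close>

record ('i, 'e) tracker =
  states :: "'i set"
  alphabet :: "'e set"
  ttrans :: "'i \<Rightarrow> 'e \<Rightarrow> 'i option"
  initial :: "'i"
  marked :: "'i set"

definition cell_step ::
  "('b, 'e) sts \<Rightarrow> ('b \<Rightarrow> bool) \<Rightarrow> 'i set \<Rightarrow> ('i \<Rightarrow> 'b set) \<Rightarrow> 'i \<Rightarrow> 'e \<Rightarrow> 'i \<Rightarrow> bool" where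
  "cell_step G P I B i \<sigma> j \<longleftrightarrow> j \<in> I \<and>
     (\<exists>b\<in>B i. transition (closed_loop G P) b \<sigma> \<noteq> None) \<and>
     (\<forall>b'\<in>B i. set_option (transition (closed_loop G P) b' \<sigma>) \<subseteq> B j)"

definition cell_trans ::
  "('b, 'e) sts \<Rightarrow> ('b \<Rightarrow> bool) \<Rightarrow> 'i set \<Rightarrow> ('i \<Rightarrow> 'b set) \<Rightarrow> ('i \<Rightarrow> 'e \<Rightarrow> 'i option) \<Rightarrow> bool" where
  "cell_trans G P I B \<delta>' \<longleftrightarrow>
     (\<forall>i\<in>I. \<forall>\<sigma>\<in>events G. case \<delta>' i \<sigma> of
        None \<Rightarrow> \<not> (\<exists>j. cell_step G P I B i \<sigma> j)
      | Some j \<Rightarrow> cell_step G P I B i \<sigma> j)"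

(* A relation rather than a function, since the initial cell and the targets of
   transitions may be chosen arbitrarily among the admissible ones.  Sk is the
   whole alphabet of the agent.  If several basic trees satisfy the initial
   predicate of the closed loop, any of them may serve as the initial one. *)
definition local_state_tracker ::
  "('b, 'e) sts \<Rightarrow> ('b \<Rightarrow> bool) \<Rightarrow> 'e set \<Rightarrow> 'i set \<Rightarrow> ('i \<Rightarrow> 'b set) \<Rightarrow> ('i, 'e) tracker \<Rightarrow> bool" where
  "local_state_tracker G P Sk I B A \<longleftrightarrow>
     states A = I \<and>
     initial A \<in> I \<and> (\<exists>b0\<in>B (initial A). init (closed_loop G P) b0) \<and>
     marked A = {i \<in> I. B i \<inter> {b \<in> sup_states G P. marker (closed_loop G P) b} \<noteq> {}} \<and>
     (\<exists>\<delta>'. cell_trans G P I B \<delta>' \<and>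
        alphabet A = Sk \<union> {\<sigma> \<in> events G - Sk. \<exists>i\<in>I. \<exists>j\<in>I. i \<noteq> j \<and> \<delta>' i \<sigma> = Some j} \<and>
        ttrans A = (\<lambda>i \<sigma>. if i \<in> I \<and> \<sigma> \<in> alphabet A then \<delta>' i \<sigma> else None))"

definition local_control ::
  "('b, 'e) sts \<Rightarrow> ('b \<Rightarrow> bool) \<Rightarrow> ('i \<Rightarrow> 'b set) \<Rightarrow> 'e \<Rightarrow> 'i \<Rightarrow> bool" where
  "local_control G P B \<sigma> i \<longleftrightarrow> (\<exists>b\<in>B i. Gam G (N_good G P \<sigma>) \<sigma> b)"

end

theory Submission
  imports Defs
begin

text \<open>Every cell containing \<open>b\<close> serves as the required \<open>i\<close>. At a
  tree of S where \<sigma> is defined, the unique successor either lies in S or does not, so exactly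
  one of \<open>En\<close> and \<open>Dis\<close> holds, and control by the supervisor amounts to
  \<open>En\<close>. The local control function asks only whether some tree of the cell satisfies
  \<open>En\<close>. Control consistency forbids a cell from containing one tree with
  \<open>En\<close> and another with \<open>Dis\<close>, so this answer is right for every tree of
  the cell at which \<sigma> is defined; \<open>local_control_iff_control\<close> records this.
  Marking needs no such comparison: closed-loop marking is plant marking cut down to S, and
  \<open>b\<close> already lies in S.\<close>

lemma local_control_iff_control:
  assumes cover: "control_cover G P Sck I B"
    and \<sigma>: "\<sigma> \<in> Sck" and i: "i \<in> I" and b: "b \<in> B i"
    and enabled: "transition G b \<sigma> = Some b'"
  shows "local_control G P B \<sigma> i \<longleftrightarrow> control G P \<sigma> b"
proof
  assume "control G P \<sigma> b"
  \<comment> \<open>The tree \<open>b\<close> is its own witness: its successor lies in S, and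
    \<open>Next\<close> holds there because of this very transition.\<close>
  with enabled have "Gam G (N_good G P \<sigma>) \<sigma> b"
    by (auto simp: control_def Gam_def N_good_def Next_def)
  with b show "local_control G P B \<sigma> i"
    by (auto simp: local_control_def)
next
  assume "local_control G P B \<sigma> i"
  then obtain c where c: "c \<in> B i" and good: "Gam G (N_good G P \<sigma>) \<sigma> c"
    by (auto simp: local_control_def)
  have consistent: "(c, b) \<in> control_consistent G P Sck"
    using cover i b c by (auto simp: control_cover_def)
  \<comment> \<open>\<open>En\<close> and \<open>Dis\<close> both carry the conjunct S, which comes
    from the consistency relation living on \<open>sup_states G P\<close>.\<close>
  then have S: "sup_pred G P b" "sup_pred G P c"
    by (auto simp: control_consistent_def sup_states_def)
  have "En G P \<sigma> c"
    using good S by (simp add: En_def)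
  with consistent \<sigma> have not_Dis: "\<not> Dis G P \<sigma> b"
    by (auto simp: control_consistent_def)
  show "control G P \<sigma> b"
  proof (rule ccontr)
    assume "\<not> control G P \<sigma> b"
    \<comment> \<open>Disabling a defined event means that the successor \<open>b'\<close> is
      outside S, hence in \<open>N_bad\<close>.\<close>
    with enabled S have "Dis G P \<sigma> b"
      by (auto simp: control_def Dis_def Gam_def N_bad_def Next_def)
    with not_Dis show False ..
  qed
qed

theorem theorem2:
  fixes G :: "('b::finite, 'e) sts"
    and P :: "'b \<Rightarrow> bool"
    and n :: nat
    and Sc Su :: "nat \<Rightarrow> 'e set"
    and I :: "nat \<Rightarrow> 'i set"
    and B :: "nat \<Rightarrow> 'i \<Rightarrow> 'b set"
    and A :: "nat \<Rightarrow> ('i, 'e) tracker"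
  assumes "state_tree_structure G"
    and "plant_agents G n Sc Su"
    and "inf (supNC G P) (init G) \<noteq> bot"
    and "\<And>k. k \<in> {1..n} \<Longrightarrow> control_cover G P (Sc k) (I k) (B k)"
    and "\<And>k. k \<in> {1..n} \<Longrightarrow> local_state_tracker G P (Sc k \<union> Su k) (I k) (B k) (A k)"
  shows "\<forall>k\<in>{1..n}. \<forall>\<sigma>\<in>Sc k. \<forall>b\<in>sup_states G P.
           \<exists>i\<in>states (A k). b \<in> B k i \<and>
             (transition G b \<sigma> \<noteq> None \<longrightarrow> (control G P \<sigma> b \<longleftrightarrow> local_control G P (B k) \<sigma> i)) \<and>
             (marker (closed_loop G P) b \<longleftrightarrow> marker G b \<and> i \<in> marked (A k))"
proof (intro ballI)
  fix k \<sigma> b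
  assume k: "k \<in> {1..n}" and \<sigma>: "\<sigma> \<in> Sc k" and b: "b \<in> sup_states G P"
  note cover = assms(4)[OF k] and tracker = assms(5)[OF k]
  have "b \<in> (\<Union>i\<in>I k. B k i)"
    using cover b by (simp add: control_cover_def cover_def)
  \<comment> \<open>An arbitrary cell around \<open>b\<close>; the same index serves control and
    marking.\<close>
  then obtain i where i: "i \<in> I k" and bi: "b \<in> B k i"
    by blast
  have "states (A k) = I k"
    using tracker by (simp add: local_state_tracker_def)
  moreover have "transition G b \<sigma> \<noteq> None \<longrightarrow> (control G P \<sigma> b \<longleftrightarrow> local_control G P (B k) \<sigma> i)"
    using local_control_iff_control[OF cover \<sigma> i bi] by auto
  \<comment> \<open>From left to right, \<open>b\<close> itself witnesses that its cell meets the
    marked trees; conversely, \<open>b\<close> in S turns \<open>marker G b\<close> into closed-loop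
    marking.\<close>
  moreover have "marker (closed_loop G P) b \<longleftrightarrow> marker G b \<and> i \<in> marked (A k)"
    using tracker b i bi by (auto simp: local_state_tracker_def closed_loop_def sup_states_def)
  ultimately show "\<exists>i\<in>states (A k). b \<in> B k i \<and>
      (transition G b \<sigma> \<noteq> None \<longrightarrow> (control G P \<sigma> b \<longleftrightarrow> local_control G P (B k) \<sigma> i)) \<and>
      (marker (closed_loop G P) b \<longleftrightarrow> marker G b \<and> i \<in> marked (A k))"
    using i bi by blast
qed

end
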